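(* Let $n\ge 1$ be an integer and let $x_1,\ldots,x_n,m$ be nonnegative integers. Let $A(x_1,\ldots,x_n;m)$ denote the number of $n$-tuples $(\mu_1,\mu_2,\ldots,\mu_n)$, where $\mu_r$ is a partition into $x_r$ distinct parts for each $r$, and the sum of all of the parts of all the $\mu_r$ is $m$. Let $B(x_1,\ldots,x_n;m)$ denote the number of partitions $\lambda_1+\cdots+\lambda_s$ of $m$ into distinct parts occurring in $2^n-1$ colors (the part $\lambda_i$ having color $c_i\in\{1,\ldots,2^n-1\}$), where (i) $\lambda_s\ge\omega(c_s)$; (ii) for each $1\le r\le n$, exactly $x_r$ of the colors $c_i$ have $2^{r-1}$ in their binary representations; and (iii) $\lambda_i-\lambda_{i+1}\ge\omega(c_i)+\delta(c_i,c_{i+1})$ for all $1\le i<s$. Then $$A(x_1,\ldots,x_n;m)=B(x_1,\ldots,x_n;m).$$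
   Context: All parts of partitions are positive integers; the empty partition is allowed. In a colored partition each part is a positive integer (its size) together with a color, and the parts are written in decreasing order $\lambda_1,\ldots,\lambda_s$, ordered first by size and then by color; "distinct" means that no (size, color) pair is repeated. In inequalities, $\lambda_i$ denotes the size of the $i$-th part and $c_i$ its color. For a positive integer $c$: $\omega(c)$ is the number of powers of $2$ occurring in the binary representation of $c$; $v(c)$ (resp. $z(c)$) is the smallest (resp. largest) power of $2$ occurring in the binary representation of $c$. The function $\delta(c,d)$ equals $1$ if $z(c)<v(d)$ and $0$ otherwise. *)

theory Defs
  imports Main "HOL-Library.FuncSet"
begin

definition distinct_partition :: "nat list \<Rightarrow> bool" where
  "distinct_partition \<mu> \<longleftrightarrow> sorted_wrt (>) \<mu> \<and> (\<forall>a\<in>set \<mu>. 0 < a)"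

text \<open>The \<open>n\<close>-tuples of partitions are the extensional functions on \<open>{1..n}\<close>; only the values
  of \<open>x\<close> on \<open>{1..n}\<close> matter.\<close>

definition tuples_A :: "nat \<Rightarrow> (nat \<Rightarrow> nat) \<Rightarrow> nat \<Rightarrow> (nat \<Rightarrow> nat list) set" where
  "tuples_A n x m =
     {\<mu> \<in> {1..n} \<rightarrow>\<^sub>E {p. distinct_partition p}.
        (\<forall>r\<in>{1..n}. length (\<mu> r) = x r) \<and> (\<Sum>r\<in>{1..n}. sum_list (\<mu> r)) = m}"

definition count_A :: "nat \<Rightarrow> (nat \<Rightarrow> nat) \<Rightarrow> nat \<Rightarrow> nat" where
  "count_A n x m = card (tuples_A n x m)"

definition binary_powers :: "nat \<Rightarrow> nat set" where
  "binary_powers c = {2 ^ k | k. bit c k}"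

definition \<omega> :: "nat \<Rightarrow> nat" where
  "\<omega> c = card (binary_powers c)"

text \<open>\<open>v\<close> and \<open>z\<close> are meaningful only for \<open>c > 0\<close>, when \<open>binary_powers c\<close> is nonempty (it is
  always finite).\<close>

definition v :: "nat \<Rightarrow> nat" where
  "v c = Min (binary_powers c)"

definition z :: "nat \<Rightarrow> nat" where
  "z c = Max (binary_powers c)"

definition \<delta> :: "nat \<Rightarrow> nat \<Rightarrow> nat" where
  "\<delta> c d = (if z c < v d then 1 else 0)"

text \<open>A colored part is a pair (size, color). Parts are listed in strictly decreasing order, by size
  and then by color, so that no pair is repeated.\<close>

definition distinct_colored_partition :: "nat set \<Rightarrow> (nat \<times> nat) list \<Rightarrow> bool" where
  "distinct_colored_partition C \<Lambda> \<longleftrightarrow>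
     sorted_wrt (\<lambda>(a, c) (b, d). b < a \<or> (b = a \<and> d < c)) \<Lambda> \<and>
     (\<forall>(a, c)\<in>set \<Lambda>. 0 < a \<and> c \<in> C)"

text \<open>List positions start at 0, so \<open>\<Lambda> ! i\<close> is the part with index \<open>i + 1\<close> in
  \<open>\<lambda>\<^sub>1, \<dots>, \<lambda>\<^sub>s\<close>. Differences of sizes are taken in the integers.\<close>

definition partitions_B :: "nat \<Rightarrow> (nat \<Rightarrow> nat) \<Rightarrow> nat \<Rightarrow> (nat \<times> nat) list set" where
  "partitions_B n x m =
     {\<Lambda>. distinct_colored_partition {1..2 ^ n - 1} \<Lambda> \<and> sum_list (map fst \<Lambda>) = m \<and>
        (\<Lambda> \<noteq> [] \<longrightarrow> fst (last \<Lambda>) \<ge> \<omega> (snd (last \<Lambda>))) \<and>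
        (\<forall>r\<in>{1..n}. card {i. i < length \<Lambda> \<and> 2 ^ (r - 1) \<in> binary_powers (snd (\<Lambda> ! i))} = x r) \<and>
        (\<forall>i. i + 1 < length \<Lambda> \<longrightarrow>
           int (fst (\<Lambda> ! i)) - int (fst (\<Lambda> ! (i + 1)))
             \<ge> int (\<omega> (snd (\<Lambda> ! i)) + \<delta> (snd (\<Lambda> ! i)) (snd (\<Lambda> ! (i + 1)))))}"

definition count_B :: "nat \<Rightarrow> (nat \<Rightarrow> nat) \<Rightarrow> nat \<Rightarrow> nat" where
  "count_B n x m = card (partitions_B n x m)"

text \<open>Both sets are finite, so \<open>card\<close> really counts.\<close>

lemma length_le_sum_list:
  fixes xs :: "nat list"
  assumes "\<forall>a\<in>set xs. 0 < a"
  shows "length xs \<le> sum_list xs"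
  using assms by (induction xs) auto

lemma finite_tuples_A: "finite (tuples_A n x m)"
proof (rule finite_subset)
  let ?L = "{p. set p \<subseteq> {..m} \<and> length p \<le> m}"
  show "finite ({1..n} \<rightarrow>\<^sub>E ?L)"
    by (intro finite_PiE finite_lists_length_le) auto
  show "tuples_A n x m \<subseteq> {1..n} \<rightarrow>\<^sub>E ?L"
  proof
    fix \<mu> assume \<mu>: "\<mu> \<in> tuples_A n x m"
    have "\<mu> r \<in> ?L" if r: "r \<in> {1..n}" for r
    proof -
      have "distinct_partition (\<mu> r)"
        using \<mu> r by (auto simp: tuples_A_def dest: PiE_mem)
      then have len: "length (\<mu> r) \<le> sum_list (\<mu> r)"
        by (intro length_le_sum_list) (simp add: distinct_partition_def)
      have "sum_list (\<mu> r) \<le> (\<Sum>r\<in>{1..n}. sum_list (\<mu> r))"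
        using r by (intro member_le_sum) auto
      then have le: "sum_list (\<mu> r) \<le> m"
        using \<mu> by (simp add: tuples_A_def)
      have "set (\<mu> r) \<subseteq> {..m}"
        using le member_le_sum_list order_trans by fastforce
      with len le show ?thesis by simp
    qed
    moreover have "\<mu> \<in> extensional {1..n}"
      using \<mu> by (auto simp: tuples_A_def PiE_def)
    ultimately show "\<mu> \<in> {1..n} \<rightarrow>\<^sub>E ?L"
      by (auto simp: PiE_def)
  qed
qed

lemma finite_partitions_B: "finite (partitions_B n x m)"
proof (rule finite_subset)
  let ?L = "{\<Lambda> :: (nat \<times> nat) list. set \<Lambda> \<subseteq> {..m} \<times> {1..2 ^ n - 1} \<and> length \<Lambda> \<le> m}"
  show "finite ?L"
    by (intro finite_lists_length_le) auto
  show "partitions_B n x m \<subseteq> ?L"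
  proof
    fix \<Lambda> assume \<Lambda>: "\<Lambda> \<in> partitions_B n x m"
    have pos: "\<forall>a\<in>set (map fst \<Lambda>). 0 < a" and col: "\<forall>c\<in>snd ` set \<Lambda>. c \<in> {1..2 ^ n - 1}"
      and sum: "sum_list (map fst \<Lambda>) = m"
      using \<Lambda> unfolding partitions_B_def distinct_colored_partition_def by auto
    have "length \<Lambda> \<le> m"
      using length_le_sum_list[OF pos] sum by simp
    moreover have "p \<in> {..m} \<times> {1..2 ^ n - 1}" if "p \<in> set \<Lambda>" for p
    proof -
      have "fst p \<le> m"
        using member_le_sum_list[of "fst p" "map fst \<Lambda>"] sum that by simp
      moreover have "snd p \<in> {1..2 ^ n - 1}"
        using col that by blast
      ultimately show ?thesis
        by (simp add: mem_Times_iff)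
    qed
    ultimately show "\<Lambda> \<in> ?L" by blast
  qed
qed

end

theory Submission
  imports Defs "HOL-Library.Product_Lexorder"
begin

text \<open>The proof attaches a word to each object and shows that, for every single word, equally many
  objects of both kinds carry it. The words have letters \<open>0, \<dots>, n - 1\<close>, and the letter \<open>k\<close> occurs
  \<open>x (Suc k)\<close> times.

  For a tuple of partitions, list all parts by increasing size, and parts of equal size by
  increasing index of the partition they belong to; the indices, lowered by \<open>1\<close>, spell the
  word \<open>w\<close>. The sizes
  increase weakly, and strictly where \<open>w\<close> has a weak descent. A strict step after which
  \<open>j\<close> parts follow costs \<open>j\<close>, so the tuples with word \<open>w\<close> of length \<open>X\<close> have generating function
  \<open>q\<^bsup>e(w)\<^esup> / ((1 - q) \<cdots> (1 - q\<^bsup>X\<^esup>))\<close>, where \<open>e(w)\<close> is \<open>X\<close> plus the number of letters to the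
  right of each weak descent (\<open>count_A_eq_sum\<close>).

  For a colored partition, write every color as the increasing list of the positions of its binary
  digits \<open>1\<close>, and concatenate these blocks, starting from the largest part. The function \<open>\<delta>\<close> is \<open>1\<close>
  exactly when the boundary between two blocks is an ascent of the word. Hence the color sequences
  with word \<open>w\<close> arise by cutting \<open>w\<close> at every weak descent and at some ascents, each cut ascent
  being penalized by one extra unit in the gap. A color sequence with \<open>s\<close> blocks has
  generating function \<open>q\<^bsup>W\<^esup> / ((1 - q) \<cdots> (1 - q\<^bsup>s\<^esup>))\<close>, where \<open>W\<close> is the least possible size of a
  partition with these colors (\<open>count_B_eq_sum\<close>).

  It remains to sum over the ways of cutting \<open>w\<close>. At each ascent the cut and the uncut version
  combine by
  \<open>1/((1 - q) \<cdots> (1 - q\<^bsup>k\<^esup>)) + q\<^bsup>k+1\<^esup>/((1 - q) \<cdots> (1 - q\<^bsup>k+1\<^esup>)) = 1/((1 - q) \<cdots> (1 - q\<^bsup>k+1\<^esup>))\<close>,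
  where \<open>k + 1\<close> is the number of blocks to the left plus the number of letters from the ascent on.
  The penalty, together with the shift of all later gaps by one position, makes the exponents of the
  two versions differ by exactly this \<open>k + 1\<close>. The whole sum therefore collapses to
  \<open>q\<^bsup>e(w)\<^esup> / ((1 - q) \<cdots> (1 - q\<^bsup>X\<^esup>))\<close> (\<open>sum_block_lists\<close>).\<close>

section \<open>Lists with prescribed gaps\<close>

primrec suffix_sums :: "nat list \<Rightarrow> nat list" where
  "suffix_sums [] = []"
| "suffix_sums (g # gs) = sum_list (g # gs) # suffix_sums gs"

text \<open>The gap in position \<open>i\<close> (counted from \<open>1\<close>) is part of the first \<open>i\<close> entries of the decreasing list
  with gaps \<open>gs\<close>, so this is the weighted sum of \<open>i\<close> times the \<open>i\<close>-th gap.\<close>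

definition gap_weight :: "nat list \<Rightarrow> nat" where
  "gap_weight gs = sum_list (suffix_sums gs)"

text \<open>The last entry has no successor; its prescribed gap is a lower bound for the entry itself.\<close>

fun respects_gaps :: "nat list \<Rightarrow> nat list \<Rightarrow> bool" where
  "respects_gaps [] [] \<longleftrightarrow> True"
| "respects_gaps [b] [l] \<longleftrightarrow> b \<le> l"
| "respects_gaps (b # b' # bs) (l # l' # ls) \<longleftrightarrow> b + l' \<le> l \<and> respects_gaps (b' # bs) (l' # ls)"
| "respects_gaps _ _ \<longleftrightarrow> False"

text \<open>The coefficient of \<open>q\<^bsup>m\<^esup>\<close> in \<open>q\<^bsup>W\<^esup> / ((1 - q) \<cdots> (1 - q\<^bsup>k\<^esup>))\<close>. Keeping \<open>W\<close> as a parameter avoids the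
  truncated difference \<open>m - W\<close>.\<close>

definition gap_count :: "nat \<Rightarrow> nat \<Rightarrow> nat \<Rightarrow> nat" where
  "gap_count k W m = card {gs. length gs = k \<and> W + gap_weight gs = m}"

lemma length_suffix_sums [simp]: "length (suffix_sums gs) = length gs"
  by (induction gs) auto

lemma gap_weight_Nil [simp]: "gap_weight [] = 0"
  by (simp add: gap_weight_def)

lemma gap_weight_Cons [simp]: "gap_weight (g # gs) = g + sum_list gs + gap_weight gs"
  by (simp add: gap_weight_def)

lemma gap_weight_snoc [simp]: "gap_weight (gs @ [g]) = gap_weight gs + Suc (length gs) * g"
  by (induction gs) auto

lemma sum_list_le_gap_weight: "sum_list gs \<le> gap_weight gs"
  by (induction gs) auto

lemma gap_weight_map2_add:
  "length bs = length gs \<Longrightarrow> gap_weight (map2 (+) bs gs) = gap_weight bs + gap_weight gs"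
proof (induction bs gs rule: list_induct2)
  case (Cons b bs g gs)
  have "sum_list (map2 (+) bs gs) = sum_list bs + sum_list gs"
    using Cons.hyps by (induction bs gs rule: list_induct2) auto
  with Cons.IH show ?case by simp
qed simp

lemma inj_suffix_sums: "inj suffix_sums"
proof (rule injI)
  show "suffix_sums xs = suffix_sums ys \<Longrightarrow> xs = ys" for xs ys
  proof (induction xs arbitrary: ys)
    case Nil
    then show ?case by (cases ys) auto
  next
    case (Cons x xs)
    then obtain y ys' where ys: "ys = y # ys'" by (cases ys) auto
    then have "xs = ys'" using Cons by simp
    then show ?case using Cons.prems ys by simp
  qed
qed

lemma respects_gaps_Cons_Cons:
  "respects_gaps (b # bs) (l # l' # ls) \<longleftrightarrow> b + l' \<le> l \<and> respects_gaps bs (l' # ls)"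
  by (cases bs) auto

lemma respects_gaps_length: "respects_gaps bs ls \<Longrightarrow> length ls = length bs"
  by (induction bs ls rule: respects_gaps.induct) auto

lemma respects_gaps_suffix_sums:
  "length gs = length bs \<Longrightarrow> respects_gaps bs (suffix_sums (map2 (+) bs gs))"
proof (induction bs arbitrary: gs)
  case (Cons b bs)
  then obtain g gs' where gs: "gs = g # gs'" by (cases gs) auto
  show ?case
  proof (cases bs)
    case Nil
    then show ?thesis using gs Cons.prems by simp
  next
    case (Cons b' bs')
    then obtain g' gs'' where "gs' = g' # gs''" using gs Cons.prems by (cases gs') auto
    then show ?thesis using Cons Cons.IH[of gs'] Cons.prems gs by simp
  qed
qed simp

lemma respects_gaps_imp_suffix_sums:
  "respects_gaps bs ls \<Longrightarrow> \<exists>gs. length gs = length bs \<and> ls = suffix_sums (map2 (+) bs gs)"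
proof (induction bs ls rule: respects_gaps.induct)
  case (2 b l)
  then show ?case by (intro exI[of _ "[l - b]"]) auto
next
  case (3 b b' bs l l' ls)
  then obtain gs where gs: "length gs = length (b' # bs)"
      "l' # ls = suffix_sums (map2 (+) (b' # bs) gs)"
    by auto
  then obtain g gs' where "gs = g # gs'" by (cases gs) auto
  then show ?case using gs 3(2)
    by (intro exI[of _ "(l - (b + l')) # gs"]) auto
qed auto

text \<open>Subtracting the prescribed gaps from the actual ones leaves an arbitrary list of natural numbers,
  and the weight of the gaps is additive. Only the number and the weight of the prescribed gaps
  therefore matter.\<close>

lemma card_respects_gaps:
  "card {ls. respects_gaps bs ls \<and> sum_list ls = m} = gap_count (length bs) (gap_weight bs) m"
proof -
  let ?f = "\<lambda>gs. suffix_sums (map2 (+) bs gs)"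
  let ?G = "{gs. length gs = length bs \<and> gap_weight bs + gap_weight gs = m}"
  have sum: "sum_list (?f gs) = gap_weight bs + gap_weight gs" if "length gs = length bs" for gs
    using gap_weight_map2_add[of bs gs] that by (simp add: gap_weight_def)
  have "inj_on ?f ?G"
  proof (rule inj_onI)
    fix gs hs assume "gs \<in> ?G" "hs \<in> ?G" and eq: "?f gs = ?f hs"
    then have len: "length gs = length bs" "length hs = length bs" by auto
    have "map2 (+) bs gs = map2 (+) bs hs" using eq inj_suffix_sums by (auto dest: injD)
    then have "bs ! i + gs ! i = bs ! i + hs ! i" if "i < length bs" for i
      using len that nth_map[of i "zip bs gs"] nth_map[of i "zip bs hs"]
      by (metis (no_types, lifting) case_prod_conv length_zip min.idem nth_zip)
    then show "gs = hs" using len by (intro nth_equalityI) auto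
  qed
  then have "card (?f ` ?G) = card ?G" by (rule card_image)
  moreover have "?f ` ?G = {ls. respects_gaps bs ls \<and> sum_list ls = m}"
  proof (intro equalityI subsetI)
    fix ls assume ls: "ls \<in> {ls. respects_gaps bs ls \<and> sum_list ls = m}"
    then obtain gs where gs: "length gs = length bs" "ls = ?f gs"
      using respects_gaps_imp_suffix_sums by blast
    then have "gs \<in> ?G" using ls sum[OF gs(1)] by simp
    then show "ls \<in> ?f ` ?G" using gs(2) by blast
  qed (auto simp: sum respects_gaps_suffix_sums)
  ultimately show ?thesis
    unfolding gap_count_def by simp
qed

lemma finite_gap_lists: "finite {gs. length gs = k \<and> W + gap_weight gs = m}"
proof (rule finite_subset)
  show "finite {gs. set gs \<subseteq> {..m} \<and> length gs = k}"
    by (rule finite_lists_length_eq) simp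
  have "y \<le> m" if "y \<in> set gs" "W + gap_weight gs = m" for gs y
    using member_le_sum_list[OF that(1)] sum_list_le_gap_weight[of gs] that(2) by linarith
  then show "{gs. length gs = k \<and> W + gap_weight gs = m} \<subseteq> {gs. set gs \<subseteq> {..m} \<and> length gs = k}"
    by auto
qed

lemma finite_respects_gaps: "finite {ls. respects_gaps bs ls \<and> sum_list ls = m}"
proof (rule finite_subset)
  show "finite {ls. set ls \<subseteq> {..m} \<and> length ls = length bs}"
    by (rule finite_lists_length_eq) simp
  show "{ls. respects_gaps bs ls \<and> sum_list ls = m} \<subseteq> {ls. set ls \<subseteq> {..m} \<and> length ls = length bs}"
    using respects_gaps_length member_le_sum_list by fastforce
qed

text \<open>The last gap is either \<open>0\<close>, and can be dropped, or it can be lowered by \<open>1\<close>, which lowers all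
  \<open>Suc k\<close> entries of the list by \<open>1\<close>.\<close>

lemma gap_count_Suc:
  "gap_count (Suc k) W m = gap_count k W m + gap_count (Suc k) (W + Suc k) m"
proof -
  let ?S = "\<lambda>k W. {gs. length gs = k \<and> W + gap_weight gs = m}"
  let ?f = "\<lambda>gs. gs @ [0::nat]"
  let ?g = "\<lambda>gs. butlast gs @ [Suc (last gs)]"
  have "?S (Suc k) W = ?f ` ?S k W \<union> ?g ` ?S (Suc k) (W + Suc k)"
  proof (intro equalityI subsetI)
    fix gs assume gs: "gs \<in> ?S (Suc k) W"
    then obtain hs h where h: "gs = hs @ [h]" by (cases gs rule: rev_cases) auto
    show "gs \<in> ?f ` ?S k W \<union> ?g ` ?S (Suc k) (W + Suc k)"
    proof (cases h)
      case 0
      then show ?thesis using gs h by auto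
    next
      case (Suc h')
      then have "hs @ [h'] \<in> ?S (Suc k) (W + Suc k)" "gs = ?g (hs @ [h'])"
        using gs h by auto
      then show ?thesis by blast
    qed
  next
    fix gs assume "gs \<in> ?f ` ?S k W \<union> ?g ` ?S (Suc k) (W + Suc k)"
    then show "gs \<in> ?S (Suc k) W"
    proof
      assume "gs \<in> ?g ` ?S (Suc k) (W + Suc k)"
      then obtain hs where hs: "hs \<in> ?S (Suc k) (W + Suc k)" "gs = ?g hs" by blast
      then obtain hs' h where "hs = hs' @ [h]" by (cases hs rule: rev_cases) auto
      then show ?thesis using hs by (auto simp: algebra_simps)
    qed auto
  qed
  moreover have "card (?f ` ?S k W \<union> ?g ` ?S (Suc k) (W + Suc k)) =
      card (?f ` ?S k W) + card (?g ` ?S (Suc k) (W + Suc k))"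
  proof (rule card_Un_disjoint)
    show "finite (?f ` ?S k W)" "finite (?g ` ?S (Suc k) (W + Suc k))"
      by (rule finite_imageI, rule finite_gap_lists)+
  qed auto
  moreover have "card (?f ` ?S k W) = card (?S k W)"
    by (intro card_image) (simp add: inj_on_def)
  moreover have "card (?g ` ?S (Suc k) (W + Suc k)) = card (?S (Suc k) (W + Suc k))"
  proof (rule card_image, rule inj_onI)
    fix gs hs :: "nat list"
    assume "gs \<in> ?S (Suc k) (W + Suc k)" "hs \<in> ?S (Suc k) (W + Suc k)" "?g gs = ?g hs"
    then show "gs = hs"
      by (cases gs rule: rev_cases; cases hs rule: rev_cases) auto
  qed
  ultimately show ?thesis unfolding gap_count_def by (simp only:)
qed

section \<open>Cutting a word into increasing blocks\<close>

text \<open>A weak descent contributes the number of letters to its right.\<close>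

fun weak_descent_weight :: "nat list \<Rightarrow> nat" where
  "weak_descent_weight (a # a' # w) =
     (if a < a' then 0 else Suc (length w)) + weak_descent_weight (a' # w)"
| "weak_descent_weight _ = 0"

text \<open>The gaps that the colored parts must respect, when each color is given by its block of binary
  digit positions: the length is \<open>\<omega>\<close>, and the ascent at the boundary is \<open>\<delta>\<close>.\<close>

fun block_gaps :: "nat list list \<Rightarrow> nat list" where
  "block_gaps [] = []"
| "block_gaps [b] = [length b]"
| "block_gaps (b # b' # bs) =
     (length b + (if last b < hd b' then 1 else 0)) # block_gaps (b' # bs)"

definition block_lists :: "nat list \<Rightarrow> nat list list set" where
  "block_lists w = {bs. concat bs = w \<and> (\<forall>b\<in>set bs. b \<noteq> [] \<and> sorted_wrt (<) b)}"

lemma length_block_gaps [simp]: "length (block_gaps bs) = length bs"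
  by (induction bs rule: block_gaps.induct) auto

lemma block_lists_Nil: "block_lists [] = {[]}"
  by (auto simp: block_lists_def)

lemma block_lists_single: "block_lists [a] = {[[a]]}"
proof (intro equalityI subsetI)
  fix bs assume bs: "bs \<in> block_lists [a]"
  then obtain b cs where b: "bs = b # cs" by (cases bs) (auto simp: block_lists_def)
  with bs have "b = [a]" "concat cs = []" by (auto simp: block_lists_def append_eq_Cons_conv)
  moreover have "cs = []" using bs b \<open>concat cs = []\<close> by (cases cs) (auto simp: block_lists_def)
  ultimately show "bs \<in> {[[a]]}" using b by simp
qed (simp add: block_lists_def)

lemma block_lists_Cons_cases:
  assumes "bs \<in> block_lists (a # w)"
  obtains b bs' where "bs = (a # b) # bs'" "sorted_wrt (<) (a # b)"
    "bs' \<in> block_lists (drop (length b) w)" "take (length b) w = b"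
proof -
  from assms obtain b0 bs' where bs: "bs = b0 # bs'"
    by (cases bs) (auto simp: block_lists_def)
  with assms obtain b where b0: "b0 = a # b"
    by (cases b0) (auto simp: block_lists_def)
  have "w = b @ concat bs'" using assms bs b0 by (auto simp: block_lists_def)
  then show thesis using that[of b bs'] assms bs b0 by (auto simp: block_lists_def)
qed

text \<open>The first letter either forms a block by itself or, if it is smaller than the second one, joins
  the block that starts there.\<close>

lemma block_lists_Cons_Cons:
  "block_lists (a # a' # w) =
     (#) [a] ` block_lists (a' # w) \<union>
     (if a < a' then (\<lambda>bs. (a # hd bs) # tl bs) ` block_lists (a' # w) else {})"
  (is "_ = ?R")
proof (intro equalityI subsetI)
  fix bs assume bs: "bs \<in> block_lists (a # a' # w)"
  then obtain b bs' where b: "bs = (a # b) # bs'" "sorted_wrt (<) (a # b)"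
      "concat bs' = drop (length b) (a' # w)" "\<forall>c\<in>set bs'. c \<noteq> [] \<and> sorted_wrt (<) c"
      "take (length b) (a' # w) = b"
    by (elim block_lists_Cons_cases) (auto simp: block_lists_def)
  show "bs \<in> ?R"
  proof (cases b)
    case Nil
    then show ?thesis using b by (auto simp: block_lists_def)
  next
    case (Cons y b')
    then have "y = a'" "a < a'" using b by auto
    moreover have "b # bs' \<in> block_lists (a' # w)"
      using b Cons append_take_drop_id[of "length b" "a' # w"] by (auto simp: block_lists_def)
    then have "bs \<in> (\<lambda>bs. (a # hd bs) # tl bs) ` block_lists (a' # w)"
      using b by (intro image_eqI[of _ _ "b # bs'"]) auto
    ultimately show ?thesis by simp
  qed
next
  fix bs assume "bs \<in> ?R"
  then consider bs' where "bs = [a] # bs'" "bs' \<in> block_lists (a' # w)"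
    | bs' where "a < a'" "bs = (a # hd bs') # tl bs'" "bs' \<in> block_lists (a' # w)"
    by (auto split: if_splits)
  then show "bs \<in> block_lists (a # a' # w)"
  proof cases
    case 1
    then show ?thesis by (auto simp: block_lists_def)
  next
    case 2
    from 2(3) show ?thesis
    proof (cases rule: block_lists_Cons_cases)
      case (1 b cs)
      then show ?thesis using 2 by (auto simp: block_lists_def)
    qed
  qed
qed

lemma finite_block_lists: "finite (block_lists w)"
proof (induction w)
  case (Cons a w)
  then show ?case
    by (cases w) (simp_all add: block_lists_single block_lists_Cons_Cons)
qed (simp add: block_lists_Nil)

text \<open>The induction removes letters from the left, and the removed blocks still matter to
  what remains: with \<open>t\<close> blocks to the left, every gap is shifted by \<open>t\<close> positions and so
  counts \<open>t\<close> more times. At an ascent there are two choices. Joining the first letter to the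
  next block keeps the number of blocks; cutting adds a block, moves all later gaps by one
  position, and pays the extra unit. By the induction hypothesis the
  two choices contribute the two summands on the right of \<open>gap_count_Suc\<close>.\<close>

lemma sum_block_lists_shifted:
  "w \<noteq> [] \<Longrightarrow>
   (\<Sum>bs\<in>block_lists w.
      gap_count (t + length bs) (W + t * sum_list (block_gaps bs) + gap_weight (block_gaps bs)) m)
   = gap_count (t + length w) (W + Suc t * length w + weak_descent_weight w) m"
proof (induction w arbitrary: t W)
  case (Cons a w0)
  show ?case
  proof (cases w0)
    case Nil
    then show ?thesis by (simp add: block_lists_single add_ac)
  next
    case (Cons a' w)
    let ?X = "block_lists (a' # w)"
    let ?F = "\<lambda>t W bs. gap_count (t + length bs)
      (W + t * sum_list (block_gaps bs) + gap_weight (block_gaps bs)) m"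
    let ?join = "\<lambda>bs. (a # hd bs) # tl bs"
    note IH = Cons.IH[unfolded Cons, OF list.distinct(2)]
    have hd_block: "\<exists>b cs. bs = (a' # b) # cs" if "bs \<in> ?X" for bs
      using that by (elim block_lists_Cons_cases) auto
    \<comment> \<open>a cut at an ascent makes the gap of the block \<open>[a]\<close> equal to \<open>2\<close> instead of \<open>1\<close>\<close>
    have "?F t W ([a] # bs) = ?F (Suc t) (W + Suc t + (if a < a' then Suc t else 0)) bs"
      if "bs \<in> ?X" for bs
      using hd_block[OF that] by (auto simp: algebra_simps)
    then have split: "(\<Sum>bs\<in>(#) [a] ` ?X. ?F t W bs) =
        gap_count (Suc (t + length (a' # w)))
          (W + Suc t + (if a < a' then Suc t else 0) + Suc (Suc t) * length (a' # w)
            + weak_descent_weight (a' # w)) m"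
      using IH[of "Suc t" "W + Suc t + (if a < a' then Suc t else 0)"]
      by (subst sum.reindex) (simp_all del: block_gaps.simps)
    show ?thesis
    proof (cases "a < a'")
      case False
      then show ?thesis using split Cons
        by (simp add: block_lists_Cons_Cons algebra_simps)
    next
      case True
      have "?F t W (?join bs) = ?F t (W + Suc t) bs" if "bs \<in> ?X" for bs
      proof -
        obtain b cs where bs: "bs = (a' # b) # cs" using hd_block \<open>bs \<in> ?X\<close> by blast
        show ?thesis unfolding bs by (cases cs) (simp_all add: algebra_simps)
      qed
      moreover have "inj_on ?join ?X"
      proof (rule inj_onI)
        fix bs cs assume "bs \<in> ?X" "cs \<in> ?X" "?join bs = ?join cs"
        moreover from this obtain b bs' c cs' where "bs = (a' # b) # bs'" "cs = (a' # c) # cs'"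
          using hd_block by blast
        ultimately show "bs = cs" by simp
      qed
      ultimately have join: "(\<Sum>bs\<in>?join ` ?X. ?F t W bs) =
          gap_count (t + length (a' # w))
            (W + Suc t + Suc t * length (a' # w) + weak_descent_weight (a' # w)) m"
        using IH[of t "W + Suc t"] by (subst sum.reindex) (simp_all del: block_gaps.simps)
      have "(#) [a] ` ?X \<inter> ?join ` ?X = {}" by (auto dest!: hd_block)
      then have "(\<Sum>bs\<in>block_lists (a # a' # w). ?F t W bs) =
          (\<Sum>bs\<in>(#) [a] ` ?X. ?F t W bs) + (\<Sum>bs\<in>?join ` ?X. ?F t W bs)"
        using True by (simp add: block_lists_Cons_Cons sum.union_disjoint finite_block_lists)
      also have "\<dots> = gap_count (t + length (a # a' # w))
          (W + Suc t * length (a # a' # w) + weak_descent_weight (a # a' # w)) m"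
        unfolding split join using True
          gap_count_Suc[of "t + length (a' # w)"
            "W + Suc t * length (a # a' # w) + weak_descent_weight (a' # w)" m]
        by (simp add: algebra_simps)
      finally show ?thesis using Cons by simp
    qed
  qed
qed simp

lemma sum_block_lists:
  "(\<Sum>bs\<in>block_lists w. gap_count (length bs) (gap_weight (block_gaps bs)) m)
   = gap_count (length w) (length w + weak_descent_weight w) m"
  using sum_block_lists_shifted[of w 0 0 m] by (cases "w = []") (simp_all add: block_lists_Nil)


section \<open>Tuples of partitions as words\<close>

text \<open>The letter \<open>k\<close> stands for the partition with index \<open>k + 1\<close>, and for the binary digit \<open>2\<^bsup>k\<^esup>\<close> of a
  color.\<close>

definition words :: "nat \<Rightarrow> (nat \<Rightarrow> nat) \<Rightarrow> nat list set" where
  "words n x = {w. set w \<subseteq> {..<n} \<and> (\<forall>k<n. count_list w k = x (Suc k))}"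

text \<open>The least gaps of the sizes when (size, letter) pairs are listed in strictly decreasing
  lexicographic order: two sizes may agree only if the letters decrease. The final \<open>1\<close> makes the
  smallest size positive.\<close>

fun strict_gaps :: "nat list \<Rightarrow> nat list" where
  "strict_gaps [] = []"
| "strict_gaps [a] = [1]"
| "strict_gaps (a # a' # u) = (if a \<le> a' then 1 else 0) # strict_gaps (a' # u)"

lemma length_strict_gaps [simp]: "length (strict_gaps u) = length u"
  by (induction u rule: strict_gaps.induct) auto

lemma strict_gaps_snoc:
  "strict_gaps (u @ [a', a]) = butlast (strict_gaps (u @ [a'])) @ [if a' \<le> a then 1 else 0, 1]"
proof (induction u rule: strict_gaps.induct)
  case (3 b b' u)
  then show ?case by (auto simp flip: length_0_conv)
qed auto

lemma last_strict_gaps: "u \<noteq> [] \<Longrightarrow> last (strict_gaps u) = 1"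
  by (induction u rule: strict_gaps.induct) (auto simp flip: length_0_conv)

text \<open>The pairs are listed in decreasing order, so that the gaps are read from the largest size, but the
  word of a tuple starts with the smallest size. Hence the reversal.\<close>

lemma gap_weight_strict_gaps_rev:
  "gap_weight (strict_gaps (rev w)) = length w + weak_descent_weight w"
proof (induction w rule: weak_descent_weight.induct)
  case (1 a a' w)
  let ?gs = "strict_gaps (rev w @ [a'])"
  \<comment> \<open>a new smallest pair turns the final \<open>1\<close> into the gap between \<open>a'\<close> and \<open>a\<close>, and brings a final \<open>1\<close> of
    its own\<close>
  have "?gs \<noteq> []" by (simp flip: length_0_conv)
  then have "?gs = butlast ?gs @ [1]"
    using last_strict_gaps[of "rev w @ [a']"] append_butlast_last_id[of ?gs] by simp
  then have "gap_weight ?gs = gap_weight (butlast ?gs) + Suc (length w)"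
    using gap_weight_snoc[of "butlast ?gs" 1] by simp
  moreover have "strict_gaps (rev w @ [a', a]) = (butlast ?gs @ [if a' \<le> a then 1 else 0]) @ [1]"
    by (simp add: strict_gaps_snoc)
  then have "gap_weight (strict_gaps (rev w @ [a', a])) =
      gap_weight (butlast ?gs) + (if a' \<le> a then Suc (length w) else 0) + Suc (Suc (length w))"
    by (simp only: gap_weight_snoc) simp
  ultimately show ?case using 1 by auto
qed auto

lemma sorted_colored_iff_respects_gaps:
  fixes L :: "(nat \<times> nat) list"
  shows "sorted_wrt (>) L \<and> (\<forall>p\<in>set L. 0 < fst p) \<longleftrightarrow>
     respects_gaps (strict_gaps (map snd L)) (map fst L)"
proof (induction L rule: induct_list012)
  case (3 p q L)
  have "sorted_wrt (>) (p # q # L) \<longleftrightarrow> p > q \<and> sorted_wrt (>) (q # L)"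
    by (rule sorted_wrt2) (auto intro: transpI)
  moreover have "p > q \<longleftrightarrow> (if snd p \<le> snd q then 1 else 0) + fst q \<le> fst p"
    by (cases p; cases q) auto
  moreover have "p > q \<Longrightarrow> 0 < fst q \<Longrightarrow> 0 < fst p"
    by (cases p; cases q) auto
  moreover have "respects_gaps (strict_gaps (map snd (p # q # L))) (map fst (p # q # L)) \<longleftrightarrow>
     (if snd p \<le> snd q then 1 else 0) + fst q \<le> fst p \<and>
     respects_gaps (strict_gaps (map snd (q # L))) (map fst (q # L))"
    by (simp add: respects_gaps_Cons_Cons)
  ultimately show ?case using "3.IH" by (auto simp del: sorted_wrt.simps)
qed auto

text \<open>Tuples of partitions, written as a single list of all (size, letter) pairs.\<close>

definition sorted_letters :: "nat \<Rightarrow> (nat \<Rightarrow> nat) \<Rightarrow> nat \<Rightarrow> (nat \<times> nat) list set" where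
  "sorted_letters n x m = {L. sorted_wrt (>) L \<and> (\<forall>p\<in>set L. 0 < fst p) \<and>
     map snd L \<in> words n x \<and> sum_list (map fst L) = m}"

definition split_letters :: "nat \<Rightarrow> (nat \<times> nat) list \<Rightarrow> nat \<Rightarrow> nat list" where
  "split_letters n L = (\<lambda>r\<in>{1..n}. map fst (filter (\<lambda>p. snd p = r - 1) L))"

lemma split_letters_Suc:
  "k < n \<Longrightarrow> split_letters n L (Suc k) = map fst (filter (\<lambda>p. snd p = k) L)"
  by (simp add: split_letters_def)

lemma length_split_letters:
  "k < n \<Longrightarrow> length (split_letters n L (Suc k)) = count_list (map snd L) k"
  by (simp add: split_letters_Suc, induction L) auto

lemma sum_split_letters:
  assumes "\<forall>p\<in>set L. snd p < n"
  shows "(\<Sum>r\<in>{1..n}. sum_list (split_letters n L r)) = sum_list (map fst L)"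
proof -
  have "(\<Sum>r\<in>{1..n}. sum_list (split_letters n L r)) =
      (\<Sum>k<n. sum_list (map fst (filter (\<lambda>p. snd p = k) L)))"
    by (simp add: sum.atLeast1_atMost_eq split_letters_Suc)
  also have "\<dots> = sum_list (map fst L)"
    using assms
  proof (induction L)
    case (Cons p L)
    have "(\<Sum>k<n. sum_list (map fst (filter (\<lambda>q. snd q = k) (p # L)))) =
        (\<Sum>k<n. (if k = snd p then fst p else 0) + sum_list (map fst (filter (\<lambda>q. snd q = k) L)))"
      by (intro sum.cong) auto
    then show ?case using Cons by (simp add: sum.distrib)
  qed simp
  finally show ?thesis .
qed

lemma set_split_letters:
  "k < n \<Longrightarrow> a \<in> set (split_letters n L (Suc k)) \<longleftrightarrow> (a, k) \<in> set L"
  by (force simp: split_letters_Suc)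

lemma sorted_split_letters:
  assumes "sorted_wrt (>) L" "k < n"
  shows "sorted_wrt (>) (split_letters n L (Suc k))"
proof -
  have "sorted_wrt (>) (filter (\<lambda>p. snd p = k) L)"
    using assms(1) by (rule sorted_wrt_filter)
  then have "sorted_wrt (\<lambda>p q. fst p > fst q) (filter (\<lambda>p. snd p = k) L)"
    by (rule sorted_wrt_mono_rel[rotated]) auto
  then show ?thesis using assms(2) by (simp add: split_letters_Suc sorted_wrt_map)
qed

lemma strict_decreasing_equal:
  fixes xs ys :: "'a::linorder list"
  assumes "sorted_wrt (>) xs" "sorted_wrt (>) ys" "set xs = set ys"
  shows "xs = ys"
  using strict_sorted_equal[of "rev xs" "rev ys"] assms by (simp add: sorted_wrt_rev)

text \<open>A strictly decreasing list is determined by its set of entries, and \<open>split_letters\<close> keeps this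
  set. Conversely, the pairs of a given tuple can be sorted, because distinctness of the parts
  within each partition makes all pairs distinct.\<close>

lemma bij_betw_split_letters: "bij_betw (split_letters n) (sorted_letters n x m) (tuples_A n x m)"
  unfolding bij_betw_def
proof (intro conjI inj_onI equalityI subsetI)
  fix L M assume L: "L \<in> sorted_letters n x m" "M \<in> sorted_letters n x m"
    and eq: "split_letters n L = split_letters n M"
  have letters: "\<forall>(a, k)\<in>set L. k < n" "\<forall>(a, k)\<in>set M. k < n"
    using L by (auto simp: sorted_letters_def words_def)
  have "p \<in> set L \<longleftrightarrow> p \<in> set M" for p
    using set_split_letters[of "snd p" n "fst p" L] set_split_letters[of "snd p" n "fst p" M]
      eq letters by (cases p) auto
  then show "L = M"
    using L by (intro strict_decreasing_equal) (auto simp: sorted_letters_def)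
next
  fix \<mu> assume "\<mu> \<in> split_letters n ` sorted_letters n x m"
  then obtain L where L: "L \<in> sorted_letters n x m" and \<mu>: "\<mu> = split_letters n L" by blast
  have letters: "\<forall>p\<in>set L. snd p < n" and pos: "\<forall>(a, k)\<in>set L. 0 < a"
    using L by (auto simp: sorted_letters_def words_def)
  have "distinct_partition (split_letters n L r)" "length (split_letters n L r) = x r"
    if r: "r \<in> {1..n}" for r
  proof -
    obtain k where k: "r = Suc k" "k < n" using r by (cases r) auto
    show "distinct_partition (split_letters n L r)"
      using L pos k by (auto simp: distinct_partition_def sorted_letters_def sorted_split_letters set_split_letters)
    show "length (split_letters n L r) = x r"
      using L k by (auto simp: length_split_letters sorted_letters_def words_def)
  qed
  moreover have "split_letters n L \<in> extensional {1..n}"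
    by (simp add: split_letters_def)
  moreover have "(\<Sum>r\<in>{1..n}. sum_list (split_letters n L r)) = m"
    using L sum_split_letters[OF letters] by (simp add: sorted_letters_def)
  ultimately show "\<mu> \<in> tuples_A n x m"
    unfolding \<mu> tuples_A_def by (auto simp: PiE_def)
next
  fix \<mu> assume \<mu>: "\<mu> \<in> tuples_A n x m"
  define T where "T = (\<Union>k<n. (\<lambda>a. (a, k)) ` set (\<mu> (Suc k)))"
  define L where "L = rev (sorted_list_of_set T)"
  have "finite T" by (simp add: T_def)
  then have set_L: "set L = T" and sorted_L: "sorted_wrt (>) L"
    by (simp_all add: L_def sorted_wrt_rev)
  have part: "distinct_partition (\<mu> (Suc k))" "length (\<mu> (Suc k)) = x (Suc k)" if "k < n" for k
    using \<mu> that by (auto simp: tuples_A_def)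
  have split: "split_letters n L (Suc k) = \<mu> (Suc k)" if k: "k < n" for k
  proof (rule strict_decreasing_equal)
    show "sorted_wrt (>) (split_letters n L (Suc k))" by (rule sorted_split_letters[OF sorted_L k])
    show "sorted_wrt (>) (\<mu> (Suc k))" using part[OF k] by (simp add: distinct_partition_def)
    show "set (split_letters n L (Suc k)) = set (\<mu> (Suc k))"
      using k set_split_letters[OF k, of _ L] by (auto simp: set_L T_def)
  qed
  have eq: "split_letters n L = \<mu>"
  proof (rule extensionalityI[of _ "{1..n}"])
    show "split_letters n L \<in> extensional {1..n}" by (simp add: split_letters_def)
    show "\<mu> \<in> extensional {1..n}" using \<mu> by (auto simp: tuples_A_def PiE_def)
    show "split_letters n L r = \<mu> r" if "r \<in> {1..n}" for r
      using split[of "r - 1"] that by (cases r) auto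
  qed
  have letters: "\<forall>p\<in>set L. snd p < n" by (auto simp: set_L T_def)
  moreover have "\<forall>p\<in>set L. 0 < fst p"
    using part by (auto simp: set_L T_def distinct_partition_def)
  moreover have "count_list (map snd L) k = x (Suc k)" if "k < n" for k
    using length_split_letters[OF that, of L] split[OF that] part(2)[OF that] by simp
  moreover have "sum_list (map fst L) = m"
    using sum_split_letters[OF letters] \<mu> by (simp add: eq tuples_A_def)
  ultimately have "L \<in> sorted_letters n x m"
    using sorted_L by (auto simp: sorted_letters_def words_def)
  then show "\<mu> \<in> split_letters n ` sorted_letters n x m" using eq by blast
qed

lemma finite_words: "finite (words n x)"
proof (rule finite_subset)
  show "finite {w. set w \<subseteq> {..<n} \<and> length w = (\<Sum>k<n. x (Suc k))}"
    by (rule finite_lists_length_eq) simp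
  have "length w = (\<Sum>k<n. count_list w k)" if "set w \<subseteq> {..<n}" for w
    using sum_count_set[OF that] by simp
  then show "words n x \<subseteq> {w. set w \<subseteq> {..<n} \<and> length w = (\<Sum>k<n. x (Suc k))}"
    by (auto simp: words_def)
qed

lemma count_A_eq_sum:
  "count_A n x m = (\<Sum>w\<in>words n x. gap_count (length w) (length w + weak_descent_weight w) m)"
proof -
  let ?S = "SIGMA u:words n x. {ls. respects_gaps (strict_gaps u) ls \<and> sum_list ls = m}"
  let ?f = "\<lambda>L. (map snd L, map fst L)"
  have bij: "bij_betw ?f (sorted_letters n x m) ?S"
  proof (rule bij_betw_byWitness[where f' = "\<lambda>(u, ls). zip ls u"])
    show "\<forall>L\<in>sorted_letters n x m. (case ?f L of (u, ls) \<Rightarrow> zip ls u) = L"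
      by (simp add: zip_map_fst_snd)
    show "\<forall>p\<in>?S. ?f (case p of (u, ls) \<Rightarrow> zip ls u) = p"
      by (auto dest!: respects_gaps_length)
    show "?f ` sorted_letters n x m \<subseteq> ?S"
      by (auto simp: sorted_letters_def sorted_colored_iff_respects_gaps[symmetric])
    show "(\<lambda>(u, ls). zip ls u) ` ?S \<subseteq> sorted_letters n x m"
    proof clarify
      fix u ls assume u: "u \<in> words n x" "respects_gaps (strict_gaps u) ls" "m = sum_list ls"
      then have len: "length ls = length u" by (auto dest: respects_gaps_length)
      then show "zip ls u \<in> sorted_letters n x (sum_list ls)"
        using u sorted_colored_iff_respects_gaps[of "zip ls u"] by (auto simp: sorted_letters_def)
    qed
  qed
  have "count_A n x m = card ?S"
    unfolding count_A_def
    by (rule trans[OF bij_betw_same_card[OF bij_betw_split_letters, symmetric]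
          bij_betw_same_card[OF bij]])
  also have "\<dots> = (\<Sum>u\<in>words n x. gap_count (length u) (gap_weight (strict_gaps u)) m)"
    by (simp add: finite_words finite_respects_gaps card_respects_gaps)
  also have "\<dots> = (\<Sum>w\<in>words n x. gap_count (length w) (length w + weak_descent_weight w) m)"
    by (rule sum.reindex_bij_witness[of _ rev rev])
      (auto simp: words_def gap_weight_strict_gaps_rev[of "rev u" for u, simplified])
  finally show ?thesis .
qed

section \<open>Colored partitions as words cut into blocks\<close>

definition bits :: "nat \<Rightarrow> nat list" where
  "bits c = sorted_list_of_set {k. bit c k}"

lemma bit_less_exp: "c < 2 ^ n \<Longrightarrow> bit c k \<Longrightarrow> k < n" for c :: nat
  by (metis bit_take_bit_iff take_bit_nat_eq_self)

lemma finite_bits: "finite {k. bit (c :: nat) k}"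
proof (rule finite_subset)
  show "{k. bit c k} \<subseteq> {..<c}" using bit_less_exp[OF less_exp] by auto
qed simp

lemma set_bits [simp]: "set (bits c) = {k. bit c k}"
  by (simp add: bits_def finite_bits)

lemma strict_sorted_bits [simp]: "sorted_wrt (<) (bits c)"
  by (simp add: bits_def)

lemma bits_eq_Nil_iff [simp]: "bits c = [] \<longleftrightarrow> c = 0"
  by (metis bit_0_eq bit_eq_iff bot_apply bot_bool_def empty_Collect_eq set_bits set_empty)

lemma inj_bits: "inj bits"
  by (rule injI, rule bit_eqI) (metis mem_Collect_eq set_bits)

text \<open>The digit sets of the numbers below \<open>2 ^ n\<close> are distinct subsets of \<open>{..<n}\<close>; there are as many of
  them as there are subsets, so every subset occurs.\<close>

lemma bits_surj:
  assumes "sorted_wrt (<) b" "set b \<subseteq> {..<n}"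
  obtains c where "c < 2 ^ n" "bits c = b"
proof -
  let ?f = "\<lambda>c::nat. {k. bit c k}"
  have "inj_on ?f {..<2 ^ n}" by (rule inj_onI, rule bit_eqI) auto
  then have "card (?f ` {..<2 ^ n}) = card (Pow {..<n})"
    by (simp add: card_image card_Pow)
  moreover have "?f ` {..<2 ^ n} \<subseteq> Pow {..<n}" by (auto dest: bit_less_exp)
  ultimately have "?f ` {..<2 ^ n} = Pow {..<n}" by (simp add: card_subset_eq)
  then have "set b \<in> ?f ` {..<2 ^ n}" using assms(2) by simp
  then obtain c where c: "c \<in> {..<2 ^ n}" "set b = ?f c" by (elim imageE) (rule that)
  then have "bits c = b" using assms(1) by (intro strict_sorted_equal) auto
  with c(1) show thesis by (intro that) simp_all
qed

lemma binary_powers_eq: "binary_powers c = (\<lambda>k. 2 ^ k) ` {k. bit c k}"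
  by (auto simp: binary_powers_def)

lemma exp_in_binary_powers: "2 ^ k \<in> binary_powers c \<longleftrightarrow> bit c k"
  by (auto simp: binary_powers_def)

lemma \<omega>_eq_length_bits: "\<omega> c = length (bits c)"
proof -
  have "\<omega> c = card {k. bit c k}"
    unfolding \<omega>_def binary_powers_eq by (intro card_image) (auto simp: inj_on_def)
  then show ?thesis by (simp add: bits_def)
qed

lemma last_less_hd_iff:
  fixes xs ys :: "nat list"
  assumes "sorted_wrt (<) xs" "sorted_wrt (<) ys" "xs \<noteq> []" "ys \<noteq> []"
  shows "last xs < hd ys \<longleftrightarrow> (\<forall>x\<in>set xs. \<forall>y\<in>set ys. x < y)"
proof
  assume less: "last xs < hd ys"
  have "x \<le> last xs" if "x \<in> set xs" for x
    using assms(1,3) that by (cases xs rule: rev_cases) (auto simp: sorted_wrt_append)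
  moreover have "hd ys \<le> y" if "y \<in> set ys" for y
    using assms(2,4) that by (cases ys) auto
  ultimately show "\<forall>x\<in>set xs. \<forall>y\<in>set ys. x < y" using less by force
qed (use assms in auto)

lemma \<delta>_eq:
  assumes "c \<noteq> 0" "d \<noteq> 0"
  shows "\<delta> c d = (if last (bits c) < hd (bits d) then 1 else 0)"
proof -
  have "binary_powers e \<noteq> {} \<and> finite (binary_powers e)" if "e \<noteq> 0" for e
    using that bits_eq_Nil_iff[of e] set_empty[of "bits e"] finite_bits by (auto simp: binary_powers_eq)
  then have "z c < v d \<longleftrightarrow> (\<forall>p\<in>binary_powers c. \<forall>q\<in>binary_powers d. p < q)"
    unfolding z_def v_def using assms by auto
  also have "\<dots> \<longleftrightarrow> (\<forall>k\<in>set (bits c). \<forall>l\<in>set (bits d). k < l)"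
    by (auto simp: binary_powers_eq)
  also have "\<dots> \<longleftrightarrow> last (bits c) < hd (bits d)"
    using assms by (intro last_less_hd_iff[symmetric]) auto
  finally show ?thesis by (simp add: \<delta>_def)
qed

lemma gap_conditions_iff:
  assumes "\<forall>p\<in>set \<Lambda>. snd p \<noteq> 0"
  shows "(\<Lambda> \<noteq> [] \<longrightarrow> fst (last \<Lambda>) \<ge> \<omega> (snd (last \<Lambda>))) \<and>
     (\<forall>i. i + 1 < length \<Lambda> \<longrightarrow>
        int (fst (\<Lambda> ! i)) - int (fst (\<Lambda> ! (i + 1)))
          \<ge> int (\<omega> (snd (\<Lambda> ! i)) + \<delta> (snd (\<Lambda> ! i)) (snd (\<Lambda> ! (i + 1)))))
     \<longleftrightarrow> respects_gaps (block_gaps (map (bits \<circ> snd) \<Lambda>)) (map fst \<Lambda>)"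
  using assms
proof (induction \<Lambda> rule: induct_list012)
  case (2 p)
  then show ?case by (simp add: \<omega>_eq_length_bits)
next
  case (3 p q \<Lambda>)
  let ?Q = "\<lambda>p q. int (fst p) - int (fst q) \<ge> int (\<omega> (snd p) + \<delta> (snd p) (snd q))"
  have "(\<forall>i. i + 1 < length (p # q # \<Lambda>) \<longrightarrow> ?Q ((p # q # \<Lambda>) ! i) ((p # q # \<Lambda>) ! (i + 1))) \<longleftrightarrow>
      ?Q p q \<and> (\<forall>i. i + 1 < length (q # \<Lambda>) \<longrightarrow> ?Q ((q # \<Lambda>) ! i) ((q # \<Lambda>) ! (i + 1)))"
    (is "?L \<longleftrightarrow> ?R")
  proof
    assume L: ?L
    show ?R
      using L[rule_format, of 0] L[rule_format, of "Suc i" for i] by auto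
  next
    assume R: ?R
    show ?L
    proof (intro allI impI)
      fix i assume "i + 1 < length (p # q # \<Lambda>)"
      then show "?Q ((p # q # \<Lambda>) ! i) ((p # q # \<Lambda>) ! (i + 1))" using R by (cases i) auto
    qed
  qed
  moreover have "?Q p q \<longleftrightarrow> length (bits (snd p)) +
      (if last (bits (snd p)) < hd (bits (snd q)) then 1 else 0) + fst q \<le> fst p"
    using "3.prems" by (auto simp: \<omega>_eq_length_bits \<delta>_eq)
  moreover have "respects_gaps (block_gaps (map (bits \<circ> snd) (p # q # \<Lambda>))) (map fst (p # q # \<Lambda>)) \<longleftrightarrow>
      length (bits (snd p)) + (if last (bits (snd p)) < hd (bits (snd q)) then 1 else 0) + fst q \<le> fst p \<and>
      respects_gaps (block_gaps (map (bits \<circ> snd) (q # \<Lambda>))) (map fst (q # \<Lambda>))"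
    by (simp add: respects_gaps_Cons_Cons)
  moreover have "(p # q # \<Lambda> \<noteq> [] \<longrightarrow> fst (last (p # q # \<Lambda>)) \<ge> \<omega> (snd (last (p # q # \<Lambda>)))) \<longleftrightarrow>
      (q # \<Lambda> \<noteq> [] \<longrightarrow> fst (last (q # \<Lambda>)) \<ge> \<omega> (snd (last (q # \<Lambda>))))"
    by simp
  moreover have "\<forall>p\<in>set (q # \<Lambda>). snd p \<noteq> 0" using "3.prems" by simp
  note "3.IH"(2)[OF this]
  ultimately show ?case by blast
qed simp

text \<open>Since \<open>\<omega>\<close> is positive on colors, the gap conditions alone force positive and strictly decreasing
  sizes, and the order of the colors never has to break a tie.\<close>

lemma respects_block_gaps_imp_sorted:
  assumes "\<forall>p\<in>set \<Lambda>. snd p \<noteq> 0"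
    and "respects_gaps (block_gaps (map (bits \<circ> snd) \<Lambda>)) (map fst \<Lambda>)"
  shows "sorted_wrt (\<lambda>p q. fst q < fst p) \<Lambda> \<and> (\<forall>p\<in>set \<Lambda>. 0 < fst p)"
  using assms
proof (induction \<Lambda> rule: induct_list012)
  case (2 p)
  then have "0 < length (bits (snd p))" "length (bits (snd p)) \<le> fst p" by simp_all
  then have "0 < fst p" by (rule less_le_trans)
  then show ?case by simp
next
  case (3 p q \<Lambda>)
  have "0 < length (bits (snd p))" using 3 by simp
  moreover have "length (bits (snd p)) + fst q \<le> fst p \<and>
      respects_gaps (block_gaps (map (bits \<circ> snd) (q # \<Lambda>))) (map fst (q # \<Lambda>))"
    using "3.prems"(2) by (simp add: respects_gaps_Cons_Cons comp_def)
  ultimately have "fst q < fst p"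
    and "respects_gaps (block_gaps (map (bits \<circ> snd) (q # \<Lambda>))) (map fst (q # \<Lambda>))"
    by linarith+
  moreover from "3.IH"(2)[OF _ this(2)] "3.prems"(1)
  have "sorted_wrt (\<lambda>p q. fst q < fst p) (q # \<Lambda>) \<and> (\<forall>p\<in>set (q # \<Lambda>). 0 < fst p)"
    by simp
  ultimately show ?case by auto
qed simp

lemma card_bit_eq_count_list:
  "card {i. i < length \<Lambda> \<and> 2 ^ k \<in> binary_powers (snd (\<Lambda> ! i))} =
     count_list (concat (map (bits \<circ> snd) \<Lambda>)) k"
proof -
  have distinct_count: "distinct ks \<Longrightarrow> count_list ks k = (if k \<in> set ks then 1 else 0)" for ks
    by (induction ks) auto
  have "count_list (bits c) k = (if bit c k then 1 else 0)" for c
    using distinct_count[of "bits c"] strict_sorted_iff[of "bits c"] by simp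
  then have "length (filter (\<lambda>p. bit (snd p) k) \<Lambda>) = count_list (concat (map (bits \<circ> snd) \<Lambda>)) k"
    by (induction \<Lambda>) auto
  then show ?thesis by (simp add: exp_in_binary_powers length_filter_conv_card)
qed

lemma partitions_B_iff:
  "\<Lambda> \<in> partitions_B n x m \<longleftrightarrow>
     (\<forall>p\<in>set \<Lambda>. snd p \<in> {1..2 ^ n - 1}) \<and> sum_list (map fst \<Lambda>) = m \<and>
     concat (map (bits \<circ> snd) \<Lambda>) \<in> words n x \<and>
     respects_gaps (block_gaps (map (bits \<circ> snd) \<Lambda>)) (map fst \<Lambda>)"
proof (cases "\<forall>p\<in>set \<Lambda>. snd p \<in> {1..2 ^ n - 1}")
  case True
  then have nz: "\<forall>p\<in>set \<Lambda>. snd p \<noteq> 0" by auto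
  have less: "snd p < 2 ^ n" if "p \<in> set \<Lambda>" for p
  proof -
    have "snd p \<le> 2 ^ n - 1" "(0::nat) < 2 ^ n" using True that by auto
    then show ?thesis by linarith
  qed
  have content: "concat (map (bits \<circ> snd) \<Lambda>) \<in> words n x \<longleftrightarrow>
      (\<forall>r\<in>{1..n}. card {i. i < length \<Lambda> \<and> 2 ^ (r - 1) \<in> binary_powers (snd (\<Lambda> ! i))} = x r)"
  proof -
    have "set (concat (map (bits \<circ> snd) \<Lambda>)) \<subseteq> {..<n}"
      using bit_less_exp[OF less] by auto
    moreover have "{1..n} = Suc ` {..<n}" by (simp add: image_Suc_lessThan)
    ultimately show ?thesis
      by (auto simp: words_def card_bit_eq_count_list)
  qed
  have "distinct_colored_partition {1..2 ^ n - 1} \<Lambda>"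
    if "respects_gaps (block_gaps (map (bits \<circ> snd) \<Lambda>)) (map fst \<Lambda>)"
  proof -
    have "sorted_wrt (\<lambda>p q. fst q < fst p) \<Lambda>" "\<forall>p\<in>set \<Lambda>. 0 < fst p"
      using respects_block_gaps_imp_sorted[OF nz that] by auto
    moreover from this(1) have "sorted_wrt (\<lambda>(a, c) (b, d). b < a \<or> (b = a \<and> d < c)) \<Lambda>"
      by (rule sorted_wrt_mono_rel[rotated]) auto
    ultimately show ?thesis using True by (auto simp: distinct_colored_partition_def)
  qed
  then show ?thesis
    using True gap_conditions_iff[OF nz] content by (auto simp only: partitions_B_def mem_Collect_eq)
next
  case False
  then show ?thesis by (auto simp: partitions_B_def distinct_colored_partition_def)
qed

text \<open>A colored partition amounts to its word, the blocks into which its colors cut that word,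
  and its sizes; the word and the blocks determine the gaps that the sizes must respect.\<close>

lemma count_B_eq_sum:
  "count_B n x m =
     (\<Sum>w\<in>words n x. \<Sum>bs\<in>block_lists w. gap_count (length bs) (gap_weight (block_gaps bs)) m)"
proof -
  let ?S = "SIGMA p:(SIGMA w:words n x. block_lists w).
    {ls. respects_gaps (block_gaps (snd p)) ls \<and> sum_list ls = m}"
  let ?f = "\<lambda>\<Lambda>. ((concat (map (bits \<circ> snd) \<Lambda>), map (bits \<circ> snd) \<Lambda>), map fst \<Lambda>)"
  have "inj ?f"
  proof (rule injI)
    fix \<Lambda> M assume "?f \<Lambda> = ?f M"
    then have "map fst \<Lambda> = map fst M" "map bits (map snd \<Lambda>) = map bits (map snd M)" by simp_all
    then have "map fst \<Lambda> = map fst M" "map snd \<Lambda> = map snd M"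
      using inj_bits by (simp_all only: inj_map_eq_map)
    then show "\<Lambda> = M" by (metis zip_map_fst_snd)
  qed
  then have "inj_on ?f (partitions_B n x m)" by (rule inj_on_subset) simp
  then have "card (?f ` partitions_B n x m) = card (partitions_B n x m)" by (rule card_image)
  moreover have "?f ` partitions_B n x m = ?S"
  proof (intro equalityI subsetI)
    fix p assume "p \<in> ?f ` partitions_B n x m"
    then obtain \<Lambda> where \<Lambda>: "\<Lambda> \<in> partitions_B n x m" and p: "p = ?f \<Lambda>" by blast
    have "bits (snd q) \<noteq> []" if "q \<in> set \<Lambda>" for q
      using \<Lambda> that by (fastforce simp: partitions_B_iff)
    then have "map (bits \<circ> snd) \<Lambda> \<in> block_lists (concat (map (bits \<circ> snd) \<Lambda>))"
      by (simp add: block_lists_def)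
    then show "p \<in> ?S" using \<Lambda> by (simp add: p partitions_B_iff)
  next
    fix p assume p: "p \<in> ?S"
    obtain w bs ls where p_eq: "p = ((w, bs), ls)" by (metis prod.collapse)
    with p have w: "w \<in> words n x" and bs: "bs \<in> block_lists w"
      and ls: "respects_gaps (block_gaps bs) ls" "sum_list ls = m" by auto
    have "\<exists>c. c \<in> {1..2 ^ n - 1} \<and> bits c = b" if "b \<in> set bs" for b
    proof -
      have "sorted_wrt (<) b" "set b \<subseteq> {..<n}" "b \<noteq> []"
        using bs w that by (fastforce simp: block_lists_def words_def)+
      moreover from this(1,2) obtain c where "c < 2 ^ n" "bits c = b" by (rule bits_surj)
      moreover from this \<open>b \<noteq> []\<close> have "c \<noteq> 0" by (metis bits_eq_Nil_iff)
      ultimately have "c \<in> {1..2 ^ n - 1}" by auto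
      with \<open>bits c = b\<close> show ?thesis by blast
    qed
    then obtain col where col: "\<And>b. b \<in> set bs \<Longrightarrow> col b \<in> {1..2 ^ n - 1} \<and> bits (col b) = b"
      by metis
    define \<Lambda> where "\<Lambda> = zip ls (map col bs)"
    have "length ls = length bs" using respects_gaps_length[OF ls(1)] by simp
    then have fst: "map fst \<Lambda> = ls" and snd: "map snd \<Lambda> = map col bs" by (simp_all add: \<Lambda>_def)
    have "map (bits \<circ> snd) \<Lambda> = map bits (map snd \<Lambda>)" by simp
    also have "\<dots> = bs" unfolding snd using col by (simp add: map_idI)
    finally have blocks: "map (bits \<circ> snd) \<Lambda> = bs" .
    have concat: "concat bs = w" using bs by (simp add: block_lists_def)
    have "snd q \<in> {1..2 ^ n - 1}" if "q \<in> set \<Lambda>" for q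
    proof -
      have "snd q \<in> set (map snd \<Lambda>)" using that by simp
      then show ?thesis unfolding snd using col by auto
    qed
    then have "\<Lambda> \<in> partitions_B n x m"
      unfolding partitions_B_iff blocks fst concat using w ls by blast
    then have "?f \<Lambda> \<in> ?f ` partitions_B n x m" by (rule imageI)
    then show "p \<in> ?f ` partitions_B n x m" by (simp only: blocks fst concat p_eq)
  qed
  ultimately have "count_B n x m = card ?S"
    unfolding count_B_def by (simp only:)
  also have "\<dots> = (\<Sum>(w, bs)\<in>(SIGMA w:words n x. block_lists w).
      gap_count (length bs) (gap_weight (block_gaps bs)) m)"
    by (subst card_SigmaI)
      (auto simp: finite_words finite_block_lists finite_respects_gaps card_respects_gaps
        intro!: sum.cong)
  also have "\<dots> = (\<Sum>w\<in>words n x. \<Sum>bs\<in>block_lists w.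
      gap_count (length bs) (gap_weight (block_gaps bs)) m)"
    by (rule sum.Sigma[symmetric]) (auto simp: finite_words finite_block_lists)
  finally show ?thesis .
qed

section \<open>Equality of the two counts\<close>

theorem theorem2:
  fixes n m :: nat and x :: "nat \<Rightarrow> nat"
  assumes "n \<ge> 1"
  shows "count_A n x m = count_B n x m"
  unfolding count_A_eq_sum count_B_eq_sum sum_block_lists ..

end
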